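(* Let $$T_{gap}=a_1\otimes(b_1\otimes c_1+\cdots+b_6\otimes c_6)+a_2\otimes b_6\otimes c_1+a_3\otimes(b_5\otimes c_1+b_6\otimes c_3)+a_4\otimes b_5\otimes c_2+a_5\otimes b_4\otimes c_3+a_6\otimes(b_4\otimes c_2+b_5\otimes c_3)\in(\mathbb{C}^6)^{\otimes3}.$$ The tensor $$T_{biggap}:=T_{gap}\otimes\bigl(e_1\otimes f_1\otimes g_1+e_2\otimes(f_2\otimes g_1+f_1\otimes g_2)\bigr)\in(\mathbb{C}^{12})^{\otimes3}$$ has border rank $12$ and rank at least $25$.
   Context: All vector spaces are over $\mathbb{C}$; $\{a_i\},\{b_i\},\{c_i\}$, $1\le i\le6$, are bases of three copies of $\mathbb{C}^6$ and $\{e_i\},\{f_i\},\{g_i\}$, $i=1,2$, are bases of three copies of $\mathbb{C}^2$. For $T\in A\otimes B\otimes C$ and $T'\in A'\otimes B'\otimes C'$, $T\otimes T'$ is regarded as an element of $(A\otimes A')\otimes(B\otimes B')\otimes(C\otimes C')$, a three-factor tensor, where $A\otimes A'$, $B\otimes B'$, $C\otimes C'$ are each considered as single vector spaces. The rank of a three-factor tensor is the least $r$ such that it is a sum of $r$ tensors of the form $u\otimes v\otimes w$; its border rank is the least $r$ such that it is a limit of tensors of rank $r$. *)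

theory Defs
  imports "HOL-Analysis.Analysis"
begin

text \<open>
  A tensor in \<open>\<complex>\<^sup>a \<otimes> \<complex>\<^sup>b \<otimes> \<complex>\<^sup>c\<close> is given by its coordinate array. The topology used
  for limits is the library's Euclidean topology on these arrays.
\<close>

type_synonym ('a, 'b, 'c) tensor3 = "complex ^ 'c ^ 'b ^ 'a"

definition outer2 ::
    "complex ^ 'b \<Rightarrow> complex ^ 'c \<Rightarrow> complex ^ 'c ^ 'b"  (infixr "\<otimes>" 75)
  where "v \<otimes> w = (\<chi> j k. v $ j * w $ k)"

text \<open>The tensor product of a vector in the first factor with a tensor in the other two;
  simple tensors are \<open>u \<odot> v \<otimes> w\<close>, read as \<open>u \<odot> (v \<otimes> w)\<close>.\<close>

definition outer3 ::
    "complex ^ 'a \<Rightarrow> complex ^ 'c ^ 'b \<Rightarrow> ('a::finite, 'b::finite, 'c::finite) tensor3"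
    (infixr "\<odot>" 74)
  where "u \<odot> M = (\<chi> i j k. u $ i * M $ j $ k)"

text \<open>Each \<open>A \<otimes> A'\<close> is identified with the coordinate space indexed by pairs, so that the
  product of two three-factor tensors is again a three-factor tensor.\<close>

definition kron3 ::
    "('a::finite, 'b::finite, 'c::finite) tensor3 \<Rightarrow> ('d::finite, 'e::finite, 'f::finite) tensor3
      \<Rightarrow> ('a \<times> 'd, 'b \<times> 'e, 'c \<times> 'f) tensor3"  (infixl "\<boxtimes>" 70)
  where "S \<boxtimes> T = (\<chi> i j k. S $ fst i $ fst j $ fst k * T $ snd i $ snd j $ snd k)"

definition tensor_rank :: "('a::finite, 'b::finite, 'c::finite) tensor3 \<Rightarrow> nat"
  where "tensor_rank T = (LEAST r. \<exists>u v w. T = (\<Sum>s<r. u s \<odot> v s \<otimes> w s))"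

definition border_rank :: "('a::finite, 'b::finite, 'c::finite) tensor3 \<Rightarrow> nat"
  where "border_rank T = (LEAST r. \<exists>X. (\<forall>n. tensor_rank (X n) = r) \<and> X \<longlonglongrightarrow> T)"

text \<open>The prefix \<open>vec\<close> selects linear independence and span over \<open>\<complex>\<close>; the unqualified
  constants would be the notions over \<open>\<real>\<close>.\<close>

definition is_basis :: "nat \<Rightarrow> (nat \<Rightarrow> complex ^ 'n) \<Rightarrow> bool"
  where "is_basis n x \<longleftrightarrow>
    inj_on x {1..n} \<and> vec.independent (x ` {1..n}) \<and> vec.span (x ` {1..n}) = UNIV"

definition T_gap ::
    "(nat \<Rightarrow> complex ^ 6) \<Rightarrow> (nat \<Rightarrow> complex ^ 6) \<Rightarrow> (nat \<Rightarrow> complex ^ 6) \<Rightarrow> (6, 6, 6) tensor3"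
  where "T_gap a b c =
      a 1 \<odot> (\<Sum>i=1..6. b i \<otimes> c i)
    + a 2 \<odot> (b 6 \<otimes> c 1)
    + a 3 \<odot> (b 5 \<otimes> c 1 + b 6 \<otimes> c 3)
    + a 4 \<odot> (b 5 \<otimes> c 2)
    + a 5 \<odot> (b 4 \<otimes> c 3)
    + a 6 \<odot> (b 4 \<otimes> c 2 + b 5 \<otimes> c 3)"

definition T_biggap ::
    "(nat \<Rightarrow> complex ^ 6) \<Rightarrow> (nat \<Rightarrow> complex ^ 6) \<Rightarrow> (nat \<Rightarrow> complex ^ 6)
      \<Rightarrow> (nat \<Rightarrow> complex ^ 2) \<Rightarrow> (nat \<Rightarrow> complex ^ 2) \<Rightarrow> (nat \<Rightarrow> complex ^ 2)
      \<Rightarrow> (6 \<times> 2, 6 \<times> 2, 6 \<times> 2) tensor3"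
  where "T_biggap a b c e f g =
    T_gap a b c \<boxtimes> (e 1 \<odot> (f 1 \<otimes> g 1) + e 2 \<odot> (f 2 \<otimes> g 1 + f 1 \<otimes> g 2))"

end

theory Submission
  imports Defs
begin

text \<open>
  Rank: view \<open>T_biggap\<close> as a space of \<open>12 \<times> 12\<close> matrices with rows \<open>(j, q)\<close> and columns
  \<open>(k, l)\<close>. By the substitution method, the nine rows \<open>j \<le> 3\<close> and \<open>j \<ge> 4, q = 2\<close>, and then the
  six columns \<open>k \<ge> 4\<close>, can each be removed at the cost of one rank-one term, after adding
  multiples of them to the remaining ones. The ten matrices belonging to \<open>a\<^sub>2, \<dots>, a\<^sub>6\<close> stay
  linearly independent, so at least \<open>9 + 6 + 10 = 25\<close> terms are needed.

  Border rank: the slice of \<open>T_biggap\<close> dual to \<open>a\<^sub>1 \<otimes> e\<^sub>2\<close> is invertible, which is an open condition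
  forcing rank at least 12. Conversely \<open>T_gap\<close> is a limit of tensors of rank 6: the rank-one
  matrices in its \<open>3 \<times> 3\<close> block \<open>\<langle>b\<^sub>4, b\<^sub>5, b\<^sub>6\<rangle> \<otimes> \<langle>c\<^sub>1, c\<^sub>2, c\<^sub>3\<rangle>\<close> are \<open>b\<^sub>6 \<otimes> c\<^sub>1\<close>, whose tangent
  direction \<open>b\<^sub>5 \<otimes> c\<^sub>1 + b\<^sub>6 \<otimes> c\<^sub>3\<close> is the slice of \<open>a\<^sub>3\<close>, and the conic
  \<open>(b\<^sub>5 + \<tau> b\<^sub>4) \<otimes> (c\<^sub>2 + \<tau> c\<^sub>3)\<close>. Two points near the former and four points near the latter, the
  fourth roots of unity, satisfy a linear relation up to second order, and the second-order
  defect is the slice of \<open>a\<^sub>1\<close>.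
\<close>

subsection \<open>Rank decompositions and dual bases\<close>

text \<open>\<open>d i z\<close> is the \<open>x i\<close>-coordinate of the standard unit vector at
  \<open>z\<close>. Taking coordinates of \<open>x j\<close> gives duality; expanding the unit
  vectors themselves gives completeness, which later serves to invert slices.\<close>

lemma is_basis_dual:
  fixes x :: "nat \<Rightarrow> complex ^ 'n"
  assumes "is_basis n x"
  obtains d :: "nat \<Rightarrow> 'n \<Rightarrow> complex" where
    "\<And>i j. i \<in> {1..n} \<Longrightarrow> j \<in> {1..n} \<Longrightarrow> (\<Sum>y\<in>UNIV. d i y * x j $ y) = (if i = j then 1 else 0)"
    "\<And>y z. (\<Sum>i=1..n. x i $ y * d i z) = (if y = z then 1 else 0)"
proof
  define R where "R = vec.representation (x ` {1..n})"
  have inj: "inj_on x {1..n}" and ind: "vec.independent (x ` {1..n})"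
    and sp: "v \<in> vec.span (x ` {1..n})" for v
    using assms by (auto simp: is_basis_def)
  have axis: "v = (\<Sum>y\<in>UNIV. v $ y *s axis y 1)" for v :: "complex ^ 'n"
    by (simp add: basis_expansion)
  have lin: "R v w = (\<Sum>y\<in>UNIV. v $ y * R (axis y 1) w)" for v w
  proof -
    have "R v w = R (\<Sum>y\<in>UNIV. v $ y *s axis y 1) w"
      using axis[of v] by simp
    also have "\<dots> = (\<Sum>y\<in>UNIV. v $ y * R (axis y 1) w)"
      unfolding R_def
      by (simp add: vec.representation_sum[OF ind sp] vec.representation_scale[OF ind sp] del: One_nat_def)
    finally show ?thesis .
  qed
  show "(\<Sum>y\<in>UNIV. R (axis y 1) (x i) * x j $ y) = (if i = j then 1 else 0)"
    if "i \<in> {1..n}" "j \<in> {1..n}" for i j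
  proof -
    have "(\<Sum>y\<in>UNIV. R (axis y 1) (x i) * x j $ y) = R (x j) (x i)"
      by (simp add: lin[of "x j"] mult.commute)
    also have "\<dots> = (if x j = x i then 1 else 0)"
      unfolding R_def using vec.representation_basis[OF ind, of "x j"] that by auto
    also have "\<dots> = (if i = j then 1 else 0)"
      using inj that by (auto dest: inj_onD)
    finally show ?thesis .
  qed
  show "(\<Sum>i=1..n. x i $ y * R (axis z 1) (x i)) = (if y = z then 1 else 0)" for y z
  proof -
    have "axis z 1 = (\<Sum>v\<in>x ` {1..n}. R (axis z 1) v *s v)"
      unfolding R_def using vec.sum_representation_eq[OF ind sp _ subset_refl] by simp
    also have "\<dots> = (\<Sum>i=1..n. R (axis z 1) (x i) *s x i)"
      using inj by (simp add: sum.reindex)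
    finally have "(axis z 1 :: complex ^ 'n) $ y = (\<Sum>i=1..n. R (axis z 1) (x i) *s x i) $ y"
      by simp
    then show ?thesis
      by (simp add: axis_def mult.commute)
  qed
qed

text \<open>The vectors may vanish, so this means rank at most \<open>r\<close>; it is the predicate
  minimised in \<open>tensor_rank\<close>.\<close>

definition decomposable :: "nat \<Rightarrow> ('a::finite, 'b::finite, 'c::finite) tensor3 \<Rightarrow> bool"
  where "decomposable r T \<longleftrightarrow> (\<exists>u v w. T = (\<Sum>s<r. u s \<odot> v s \<otimes> w s))"

lemma outer_nth [simp]: "(u \<odot> M) $ i $ j $ k = u $ i * M $ j $ k" "(v \<otimes> w) $ j $ k = v $ j * w $ k"
  by (simp_all add: outer3_def outer2_def)

lemma decomposableI:
  assumes "finite S" and "card S = r" and "T = (\<Sum>s\<in>S. u s \<odot> v s \<otimes> w s)"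
  shows "decomposable r T"
proof -
  obtain h where h: "bij_betw h {..<r} S"
    using assms(1,2) ex_bij_betw_nat_finite[of S] by (auto simp: lessThan_atLeast0)
  have "T = (\<Sum>s<r. u (h s) \<odot> v (h s) \<otimes> w (h s))"
    unfolding assms(3) by (rule sum.reindex_bij_betw[OF h, symmetric])
  then show ?thesis
    unfolding decomposable_def by (intro exI)
qed

text \<open>Splitting \<open>T\<close> into its rows gives one term per pair \<open>(i, j)\<close>,
  so the \<open>LEAST\<close> in \<open>tensor_rank\<close> is attained.\<close>

lemma decomposable_exists:
  fixes T :: "('a::finite, 'b::finite, 'c::finite) tensor3"
  shows "\<exists>r. decomposable r T"
proof -
  have "T = (\<Sum>(i, j)\<in>UNIV. axis i 1 \<odot> axis j 1 \<otimes> (T $ i $ j))"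
  proof (intro vec_eq_iff[THEN iffD2] allI)
    fix i j k
    have "(\<Sum>(i', j')\<in>UNIV. axis i' 1 \<odot> axis j' 1 \<otimes> (T $ i' $ j')) $ i $ j $ k
        = (\<Sum>p\<in>UNIV. if p = (i, j) then T $ i $ j $ k else 0)"
      unfolding sum_component by (intro sum.cong) (auto simp: axis_def split: if_splits)
    then show "T $ i $ j $ k = (\<Sum>(i', j')\<in>UNIV. axis i' 1 \<odot> axis j' 1 \<otimes> (T $ i' $ j')) $ i $ j $ k"
      by simp
  qed
  then have "decomposable (card (UNIV :: ('a \<times> 'b) set)) T"
    by (intro decomposableI[of UNIV _ T "\<lambda>(i, j). axis i 1" "\<lambda>(i, j). axis j 1" "\<lambda>(i, j). T $ i $ j"])
      (simp_all add: case_prod_unfold)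
  then show ?thesis ..
qed

lemma decomposable_tensor_rank: "decomposable (tensor_rank T) T"
  using decomposable_exists[of T] unfolding tensor_rank_def decomposable_def by (rule LeastI_ex)

lemma tensor_rank_le: "decomposable r T \<Longrightarrow> tensor_rank T \<le> r"
  unfolding tensor_rank_def decomposable_def by (rule Least_le)

text \<open>By hypothesis the columns \<open>\<lambda>s. V s i\<close> are independent on
  \<open>S\<close>, so some \<open>card I\<close> rows form an invertible square matrix.
  Invertibility is phrased as solvability because substitution uses it that way: \<open>c\<close>
  cancels \<open>h\<close> on all terms of \<open>S'\<close> at once.\<close>

lemma full_rank_square_subsystem:
  fixes V :: "'s \<Rightarrow> 'i \<Rightarrow> complex"
  assumes "finite I" and "finite S"
    and "\<And>d. \<exists>i\<in>I. d i \<noteq> 0 \<Longrightarrow> \<exists>s\<in>S. (\<Sum>i\<in>I. d i * V s i) \<noteq> 0"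
  obtains S' where "S' \<subseteq> S" and "card S' = card I"
    and "\<And>h. \<exists>c. \<forall>s\<in>S'. h s + (\<Sum>i\<in>I. c i * V s i) = 0"
proof -
  have "\<exists>S'\<subseteq>S. card S' = card I \<and> (\<forall>h. \<exists>c. \<forall>s\<in>S'. h s + (\<Sum>i\<in>I. c i * V s i) = 0)"
    using assms(1,3)
  proof (induction I)
    case empty
    then show ?case by (intro exI[of _ "{}"]) auto
  next
    case (insert i0 I)
    have upd: "(\<Sum>i\<in>I. (c(i0 := m)) i * V s i) = (\<Sum>i\<in>I. c i * V s i)" for c m s
      using insert.hyps by (intro sum.cong) auto
    have "\<exists>s\<in>S. (\<Sum>i\<in>I. d i * V s i) \<noteq> 0" if "\<exists>i\<in>I. d i \<noteq> 0" for d
    proof -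
      have "\<exists>i\<in>insert i0 I. (d(i0 := 0)) i \<noteq> 0"
        using that insert.hyps by auto
      from insert.prems[OF this] show ?thesis
        using insert.hyps by (simp add: upd del: fun_upd_apply) simp
    qed
    then obtain S' where S': "S' \<subseteq> S" "card S' = card I"
      and solve: "\<And>h. \<exists>c. \<forall>s\<in>S'. h s + (\<Sum>i\<in>I. c i * V s i) = 0"
      using insert.IH by blast
    \<comment> \<open>Column \<open>i0\<close> is reduced by the others until it vanishes on
      \<open>S'\<close>; independence then yields a row \<open>s0\<close> where the reduced column
      is nonzero.\<close>
    obtain c where c: "\<forall>s\<in>S'. V s i0 + (\<Sum>i\<in>I. c i * V s i) = 0"
      using solve[of "\<lambda>s. V s i0"] by blast
    obtain s0 where s0: "s0 \<in> S" "V s0 i0 + (\<Sum>i\<in>I. c i * V s0 i) \<noteq> 0"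
    proof -
      have "\<exists>i\<in>insert i0 I. (c(i0 := 1)) i \<noteq> 0"
        by auto
      from insert.prems[OF this] show ?thesis
        using insert.hyps that by (simp add: upd del: fun_upd_apply) auto
    qed
    have fresh: "s0 \<notin> S'"
      using s0 c by auto
    have "\<exists>c'. \<forall>s\<in>insert s0 S'. h s + (\<Sum>i\<in>insert i0 I. c' i * V s i) = 0" for h
    proof -
      obtain c1 where c1: "\<forall>s\<in>S'. h s + (\<Sum>i\<in>I. c1 i * V s i) = 0"
        using solve by blast
      \<comment> \<open>Adding \<open>m\<close> times the reduced column preserves the equations on
        \<open>S'\<close>, and this \<open>m\<close> solves the one at \<open>s0\<close>.\<close>
      define m where "m = - (h s0 + (\<Sum>i\<in>I. c1 i * V s0 i)) / (V s0 i0 + (\<Sum>i\<in>I. c i * V s0 i))"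
      define c' where "c' = (\<lambda>i. c1 i + m * c i)(i0 := m)"
      have eq: "h s + (\<Sum>i\<in>insert i0 I. c' i * V s i)
          = (h s + (\<Sum>i\<in>I. c1 i * V s i)) + m * (V s i0 + (\<Sum>i\<in>I. c i * V s i))" for s
        unfolding c'_def using insert.hyps
        by (simp add: upd del: fun_upd_apply)
          (simp add: algebra_simps sum.distrib sum_distrib_left)
      show ?thesis
        by (rule exI[of _ c']) (use c c1 s0 in \<open>auto simp: eq m_def\<close>)
    qed
    moreover have "card (insert s0 S') = card (insert i0 I)"
      using fresh S' insert.hyps finite_subset[OF S'(1) assms(2)] by simp
    ultimately show ?case
      using S'(1) s0(1) by (intro exI[of _ "insert s0 S'"]) auto
  qed
  then show ?thesis
    using that by blast
qed

subsection \<open>The lower bound for the rank\<close>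

text \<open>Contracting with dual basis vectors reads off coordinates in arbitrary bases.\<close>

definition contract ::
    "('a \<Rightarrow> complex) \<Rightarrow> ('b \<Rightarrow> complex) \<Rightarrow> ('c \<Rightarrow> complex) \<Rightarrow> ('a::finite, 'b::finite, 'c::finite) tensor3 \<Rightarrow> complex"
  where "contract \<alpha> \<beta> \<gamma> T = (\<Sum>(i, j, k)\<in>UNIV. \<alpha> i * \<beta> j * \<gamma> k * T $ i $ j $ k)"

lemma contract_add: "contract \<alpha> \<beta> \<gamma> (S + T) = contract \<alpha> \<beta> \<gamma> S + contract \<alpha> \<beta> \<gamma> T"
  by (simp add: contract_def case_prod_unfold algebra_simps sum.distrib)

lemma contract_sum: "contract \<alpha> \<beta> \<gamma> (\<Sum>s\<in>S. T s) = (\<Sum>s\<in>S. contract \<alpha> \<beta> \<gamma> (T s))"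
  by (induction S rule: infinite_finite_induct)
    (auto simp: contract_add, auto simp: contract_def)

lemma contract_outer:
  "contract \<alpha> \<beta> \<gamma> (u \<odot> v \<otimes> w) =
    (\<Sum>i\<in>UNIV. \<alpha> i * u $ i) * (\<Sum>j\<in>UNIV. \<beta> j * v $ j) * (\<Sum>k\<in>UNIV. \<gamma> k * w $ k)"
proof -
  have "contract \<alpha> \<beta> \<gamma> (u \<odot> v \<otimes> w)
      = (\<Sum>i\<in>UNIV. \<Sum>j\<in>UNIV. \<Sum>k\<in>UNIV. (\<alpha> i * u $ i) * ((\<beta> j * v $ j) * (\<gamma> k * w $ k)))"
    unfolding contract_def UNIV_Times_UNIV[symmetric] sum.cartesian_product[symmetric]
    by (simp add: mult_ac)
  also have "\<dots> = (\<Sum>i\<in>UNIV. \<alpha> i * u $ i) * ((\<Sum>j\<in>UNIV. \<beta> j * v $ j) * (\<Sum>k\<in>UNIV. \<gamma> k * w $ k))"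
    by (simp only: sum_distrib_left[symmetric] sum_distrib_right[symmetric])
  finally show ?thesis by (simp add: mult.assoc)
qed

lemma contract_kron:
  "contract (\<lambda>(x, y). \<alpha> x * \<alpha>' y) (\<lambda>(x, y). \<beta> x * \<beta>' y) (\<lambda>(x, y). \<gamma> x * \<gamma>' y) (S \<boxtimes> T)
    = contract \<alpha> \<beta> \<gamma> S * contract \<alpha>' \<beta>' \<gamma>' T"
  unfolding contract_def sum_product sum.cartesian_product
  by (rule sum.reindex_bij_witness[of _ "\<lambda>((i, j, k), (i', j', k')). ((i, i'), (j, j'), (k, k'))"
        "\<lambda>((i, i'), (j, j'), (k, k')). ((i, j, k), (i', j', k'))"])
    (auto simp: kron3_def)

lemma outer_add: "u \<odot> (M + N) = u \<odot> M + u \<odot> N"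
  by (simp add: vec_eq_iff algebra_simps)

lemma outer_sum: "u \<odot> (\<Sum>s\<in>S. M s) = (\<Sum>s\<in>S. u \<odot> M s)"
  by (simp add: vec_eq_iff sum_distrib_left)

definition t_gap :: "nat \<Rightarrow> nat \<Rightarrow> nat \<Rightarrow> complex"
  where "t_gap i j k = of_bool (i = 1 \<and> j = k \<or>
    (i, j, k) \<in> {(2, 6, 1), (3, 5, 1), (3, 6, 3), (4, 5, 2), (5, 4, 3), (6, 4, 2), (6, 5, 3)})"

text \<open>The array of the second factor, known as the W tensor.\<close>

definition t_w :: "nat \<Rightarrow> nat \<Rightarrow> nat \<Rightarrow> complex"
  where "t_w p q l = of_bool ((p, q, l) \<in> {(1, 1, 1), (2, 2, 1), (2, 1, 2)})"

definition t_biggap :: "nat \<times> nat \<Rightarrow> nat \<times> nat \<Rightarrow> nat \<times> nat \<Rightarrow> complex"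
  where "t_biggap I J K = t_gap (fst I) (fst J) (fst K) * t_w (snd I) (snd J) (snd K)"

text \<open>Each round of substitution isolates as many terms as there are independent rows, columns
  or slices. The resulting sets \<open>SB\<close>, \<open>SC\<close>, \<open>SA\<close> of terms are
  disjoint, of sizes 9, 6 and 10.\<close>

lemma coordinate_rank_ge_25:
  fixes U V W :: "nat \<Rightarrow> nat \<times> nat \<Rightarrow> complex"
  assumes T: "\<And>I J K. I \<in> {1..6} \<times> {1..2} \<Longrightarrow> J \<in> {1..6} \<times> {1..2} \<Longrightarrow> K \<in> {1..6} \<times> {1..2} \<Longrightarrow>
    (\<Sum>s<r. U s I * V s J * W s K) = t_biggap I J K"
  shows "25 \<le> r"
proof -
  define X :: "(nat \<times> nat) set" where "X = {1..6} \<times> {1..2}"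
  \<comment> \<open>\<open>KB\<close> and \<open>KC\<close> index the rows and columns to be
    removed, \<open>KA\<close> the slices left at the end. The surviving rows are
    \<open>(j, 1)\<close> with \<open>j \<ge> 4\<close>.\<close>
  define KA :: "(nat \<times> nat) set" where "KA = {2..6} \<times> {1..2}"
  define KB :: "(nat \<times> nat) set" where "KB = {1..3} \<times> {1..2} \<union> {4..6} \<times> {2}"
  define KC :: "(nat \<times> nat) set" where "KC = {4..6} \<times> {1..2}"
  have sub: "KA \<subseteq> X" "KB \<subseteq> X" "KC \<subseteq> X"
    by (auto simp: KA_def KB_def KC_def X_def)
  have fin: "finite KA" "finite KB" "finite KC"
    by (simp_all add: KA_def KB_def KC_def)
  have ivl: "{1..2 :: nat} = {1, 2}" "{1..3 :: nat} = {1, 2, 3}" "{4..6 :: nat} = {4, 5, 6}"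
      "{2..6 :: nat} = {2, 3, 4, 5, 6}"
    by auto
  have KB_eq: "KB = {(1,1), (1,2), (2,1), (2,2), (3,1), (3,2), (4,2), (5,2), (6,2)}"
    unfolding KB_def ivl by auto
  have KC_eq: "KC = {(4,1), (4,2), (5,1), (5,2), (6,1), (6,2)}"
    unfolding KC_def ivl by auto
  have KA_eq: "KA = {(2,1), (2,2), (3,1), (3,2), (4,1), (4,2), (5,1), (5,2), (6,1), (6,2)}"
    unfolding KA_def ivl by auto
  have card: "card KA = 10" "card KB = 9" "card KC = 6"
    by (simp_all add: KA_eq KB_eq KC_eq)

  \<comment> \<open>Slice \<open>(1, 2)\<close> is a permutation matrix: its row
    \<open>(k, 3 - l)\<close> has its only entry in column \<open>(k, l)\<close>, so each column
    isolates one coefficient of \<open>d\<close>.\<close>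
  have "\<exists>s\<in>{..<r}. (\<Sum>J\<in>KB. d J * V s J) \<noteq> 0" if d: "\<exists>J\<in>KB. d J \<noteq> 0" for d
  proof (rule ccontr)
    assume neg: "\<not> ?thesis"
    have zero: "(\<Sum>J\<in>KB. d J * t_biggap I J K) = 0" if "I \<in> X" "K \<in> X" for I K
    proof -
      have "(\<Sum>J\<in>KB. d J * t_biggap I J K) = (\<Sum>J\<in>KB. d J * (\<Sum>s<r. U s I * V s J * W s K))"
        using T that sub unfolding X_def by (intro sum.cong) auto
      also have "\<dots> = (\<Sum>s<r. U s I * (\<Sum>J\<in>KB. d J * V s J) * W s K)"
        by (simp add: sum_distrib_left sum_distrib_right mult_ac sum.swap[of _ KB])
      also have "\<dots> = 0"
        using neg by simp
      finally show ?thesis .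
    qed
    have z: "(\<Sum>J\<in>KB. d J * t_biggap (1, 2) J (k, l)) = 0" if "k \<in> {1..6}" "l \<in> {1..2}" for k l
      using zero that by (simp add: X_def)
    have "d (1, 1) = 0" "d (2, 1) = 0" "d (3, 1) = 0"
      using z[of 1 2] z[of 2 2] z[of 3 2]
      unfolding KB_eq t_biggap_def t_gap_def t_w_def by simp_all
    moreover have "d (1, 2) = 0" "d (2, 2) = 0" "d (3, 2) = 0" "d (4, 2) = 0" "d (5, 2) = 0" "d (6, 2) = 0"
      using z[of 1 1] z[of 2 1] z[of 3 1] z[of 4 1] z[of 5 1] z[of 6 1]
      unfolding KB_eq t_biggap_def t_gap_def t_w_def by simp_all
    ultimately show False
      using d unfolding KB_eq by auto
  qed
  from full_rank_square_subsystem[OF fin(2) finite_lessThan this]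
  obtain SB where SB: "SB \<subseteq> {..<r}" "card SB = card KB"
    and solveB: "\<And>h. \<exists>c. \<forall>s\<in>SB. h s + (\<Sum>J\<in>KB. c J * V s J) = 0"
    by blast
  \<comment> \<open>Correcting row \<open>(j, 1)\<close> by the rows in \<open>KB\<close> makes its
    factor vanish on \<open>SB\<close>. The remaining terms then decompose the corrected tensor
    \<open>TB\<close>, whatever the coefficients \<open>c\<close> are.\<close>
  have "\<forall>j. \<exists>c. \<forall>s\<in>SB. V s (j, 1) + (\<Sum>J\<in>KB. c J * V s J) = 0"
    by (intro allI solveB)
  then obtain c where c: "\<And>j s. s \<in> SB \<Longrightarrow> V s (j, 1) + (\<Sum>J\<in>KB. c j J * V s J) = 0"
    by metis
  define V' where "V' = (\<lambda>j s. V s (j, 1) + (\<Sum>J\<in>KB. c j J * V s J))"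
  define TB where "TB = (\<lambda>I j K. t_biggap I (j, 1) K + (\<Sum>J\<in>KB. c j J * t_biggap I J K))"
  have TB: "(\<Sum>s\<in>{..<r} - SB. U s I * V' j s * W s K) = TB I j K"
    if "I \<in> X" "j \<in> {4..6}" "K \<in> X" for I j K
  proof -
    have "(\<Sum>s\<in>{..<r} - SB. U s I * V' j s * W s K) = (\<Sum>s<r. U s I * V' j s * W s K)"
      using SB c by (intro sum.mono_neutral_left) (auto simp: V'_def)
    also have "\<dots> = (\<Sum>s<r. U s I * V s (j, 1) * W s K)
        + (\<Sum>J\<in>KB. c j J * (\<Sum>s<r. U s I * V s J * W s K))"
      by (simp add: V'_def algebra_simps sum.distrib sum_distrib_left sum_distrib_right sum.swap[of _ KB])
    also have "\<dots> = TB I j K"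
    proof -
      have "(\<Sum>J\<in>KB. c j J * (\<Sum>s<r. U s I * V s J * W s K)) = (\<Sum>J\<in>KB. c j J * t_biggap I J K)"
        using T that sub unfolding X_def by (intro sum.cong) auto
      moreover have "(\<Sum>s<r. U s I * V s (j, 1) * W s K) = t_biggap I (j, 1) K"
        using T that unfolding X_def by auto
      ultimately show ?thesis by (simp add: TB_def)
    qed
    finally show ?thesis .
  qed

  \<comment> \<open>In slice \<open>(1, 1)\<close> the corrections miss the columns
    \<open>k \<ge> 4\<close>, so row \<open>j\<close> gives \<open>d (j, 1) = 0\<close>. In slice
    \<open>(1, 2)\<close> they reach only columns \<open>(k, 1)\<close> among these, whose
    coefficients are already zero, so \<open>d (j, 2) = 0\<close>.\<close>
  have "\<exists>s\<in>{..<r} - SB. (\<Sum>K\<in>KC. d K * W s K) \<noteq> 0" if d: "\<exists>K\<in>KC. d K \<noteq> 0" for d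
  proof (rule ccontr)
    assume neg: "\<not> ?thesis"
    have zero: "(\<Sum>K\<in>KC. d K * TB I j K) = 0" if "I \<in> X" "j \<in> {4..6}" for I j
    proof -
      have "(\<Sum>K\<in>KC. d K * TB I j K)
          = (\<Sum>K\<in>KC. d K * (\<Sum>s\<in>{..<r} - SB. U s I * V' j s * W s K))"
        by (intro sum.cong refl arg_cong[where f = "(*) _"] TB[symmetric]) (use that sub in blast)+
      also have "\<dots> = (\<Sum>s\<in>{..<r} - SB. U s I * V' j s * (\<Sum>K\<in>KC. d K * W s K))"
        by (simp add: sum_distrib_left mult_ac sum.swap[of _ KC])
      also have "\<dots> = 0"
        using neg by simp
      finally show ?thesis .
    qed
    have z: "(\<Sum>K\<in>KC. d K * TB (1, p) j K) = 0" if "p \<in> {1..2}" "j \<in> {4..6}" for p j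
      using zero that by (simp add: X_def)
    note unf = KB_eq KC_eq TB_def t_biggap_def t_gap_def t_w_def
    have 1: "d (4, 1) = 0" "d (5, 1) = 0" "d (6, 1) = 0"
      using z[of 1 4] z[of 1 5] z[of 1 6] unfolding unf by simp_all
    then have 2: "d (4, 2) = 0" "d (5, 2) = 0" "d (6, 2) = 0"
      using z[of 2 4] z[of 2 5] z[of 2 6] unfolding unf by simp_all
    show False
      using d 1 2 unfolding KC_eq by auto
  qed
  from full_rank_square_subsystem[OF fin(3) finite_Diff[OF finite_lessThan] this]
  obtain SC where SC: "SC \<subseteq> {..<r} - SB" "card SC = card KC"
    and solveC: "\<And>h. \<exists>c. \<forall>s\<in>SC. h s + (\<Sum>K\<in>KC. c K * W s K) = 0"
    by blast
  have "\<forall>K. \<exists>c. \<forall>s\<in>SC. W s K + (\<Sum>K'\<in>KC. c K' * W s K') = 0"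
    by (intro allI solveC)
  then obtain e where e: "\<And>K s. s \<in> SC \<Longrightarrow> W s K + (\<Sum>K'\<in>KC. e K K' * W s K') = 0"
    by metis
  define W' where "W' = (\<lambda>K s. W s K + (\<Sum>K'\<in>KC. e K K' * W s K'))"
  \<comment> \<open>Slices with \<open>i \<ge> 2\<close> are zero in the columns
    \<open>k \<ge> 4\<close>, so the column corrections leave them unchanged.\<close>
  have TBC: "(\<Sum>s\<in>{..<r} - SB - SC. U s I * V' j s * W' K s) = TB I j K"
    if I: "I \<in> KA" and j: "j \<in> {4..6}" and K: "K \<in> X" for I j K
  proof -
    have IX: "I \<in> X" using I sub by auto
    have "(\<Sum>s\<in>{..<r} - SB - SC. U s I * V' j s * W' K s) = (\<Sum>s\<in>{..<r} - SB. U s I * V' j s * W' K s)"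
      using e[of _ K] by (intro sum.mono_neutral_left) (auto simp: W'_def)
    also have "\<dots> = (\<Sum>s\<in>{..<r} - SB. U s I * V' j s * W s K)
        + (\<Sum>K'\<in>KC. e K K' * (\<Sum>s\<in>{..<r} - SB. U s I * V' j s * W s K'))"
      by (simp add: W'_def algebra_simps sum.distrib sum_distrib_left sum.swap[of _ KC])
    also have "(\<Sum>K'\<in>KC. e K K' * (\<Sum>s\<in>{..<r} - SB. U s I * V' j s * W s K'))
        = (\<Sum>K'\<in>KC. e K K' * TB I j K')"
      by (intro sum.cong refl arg_cong[where f = "(*) _"] TB) (use IX j sub in blast)+
    also have "\<dots> = 0"
    proof (rule sum.neutral, rule ballI)
      fix K' assume "K' \<in> KC"
      then have "t_biggap I J K' = 0" for J
        using I by (auto simp: t_biggap_def t_gap_def KA_def KC_def)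
      then show "e K K' * TB I j K' = 0"
        by (simp add: TB_def)
    qed
    finally show ?thesis
      using TB[OF IX j K] by simp
  qed

  \<comment> \<open>For \<open>i \<ge> 2\<close> the row corrections contribute only to slices
    \<open>(i, 2)\<close> in columns \<open>(k, 1)\<close>. Columns \<open>(k, 2)\<close> therefore
    isolate the coefficients \<open>d (i, 2)\<close>; once these vanish, columns
    \<open>(k, 1)\<close> isolate \<open>d (i, 1)\<close>.\<close>
  have "\<exists>s\<in>{..<r} - SB - SC. (\<Sum>I\<in>KA. d I * U s I) \<noteq> 0" if d: "\<exists>I\<in>KA. d I \<noteq> 0" for d
  proof (rule ccontr)
    assume neg: "\<not> ?thesis"
    have zero: "(\<Sum>I\<in>KA. d I * TB I j K) = 0" if "j \<in> {4..6}" "K \<in> X" for j K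
    proof -
      have "(\<Sum>I\<in>KA. d I * TB I j K)
          = (\<Sum>I\<in>KA. d I * (\<Sum>s\<in>{..<r} - SB - SC. U s I * V' j s * W' K s))"
        by (intro sum.cong refl arg_cong[where f = "(*) _"] TBC[symmetric]) (use that in blast)+
      also have "\<dots> = (\<Sum>s\<in>{..<r} - SB - SC. (\<Sum>I\<in>KA. d I * U s I) * V' j s * W' K s)"
        by (simp add: sum_distrib_left sum_distrib_right mult_ac sum.swap[of _ KA])
      also have "\<dots> = 0"
        using neg by simp
      finally show ?thesis .
    qed
    have z: "(\<Sum>I\<in>KA. d I * TB I j (k, l)) = 0" if "j \<in> {4..6}" "k \<in> {1..3}" "l \<in> {1..2}" for j k l
      using zero[of j "(k, l)"] that by (auto simp: X_def)
    note unf = KB_eq KA_eq TB_def t_biggap_def t_gap_def t_w_def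
    have 2: "d (2, 2) = 0" "d (3, 2) = 0" "d (4, 2) = 0" "d (5, 2) = 0" "d (6, 2) = 0"
      using z[of 6 1 2] z[of 5 1 2] z[of 5 2 2] z[of 4 3 2] z[of 4 2 2] unfolding unf by simp_all
    then have 1: "d (2, 1) = 0" "d (3, 1) = 0" "d (4, 1) = 0" "d (5, 1) = 0" "d (6, 1) = 0"
      using z[of 6 1 1] z[of 5 1 1] z[of 5 2 1] z[of 4 3 1] z[of 4 2 1] unfolding unf by simp_all
    show False
      using d 1 2 unfolding KA_eq by auto
  qed
  then obtain SA where SA: "SA \<subseteq> {..<r} - SB - SC" "card SA = card KA"
    by (rule full_rank_square_subsystem[OF fin(1) finite_Diff[OF finite_Diff[OF finite_lessThan]]])
  have fins: "finite SA" "finite SB" "finite SC"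
    using SA(1) SB(1) SC(1) by (auto intro: finite_subset)
  have "card (SA \<union> SC \<union> SB) = card SA + card SC + card SB"
    using SA(1) SC(1) fins by (subst card_Un_disjoint, auto)+
  then have "card (SA \<union> SC \<union> SB) = 25"
    using SA(2) SB(2) SC(2) card by simp
  moreover have "card (SA \<union> SC \<union> SB) \<le> card {..<r}"
    using SA(1) SB(1) SC(1) by (intro card_mono) auto
  ultimately show ?thesis by simp
qed

section \<open>Passage from the given bases to coordinates\<close>

lemma contract_T_gap:
  assumes dual: "\<And>i j. i \<in> {1..6} \<Longrightarrow> j \<in> {1..6} \<Longrightarrow> (\<Sum>y\<in>UNIV. A i y * a j $ y) = of_bool (i = j)"
    "\<And>i j. i \<in> {1..6} \<Longrightarrow> j \<in> {1..6} \<Longrightarrow> (\<Sum>y\<in>UNIV. B i y * b j $ y) = of_bool (i = j)"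
    "\<And>i j. i \<in> {1..6} \<Longrightarrow> j \<in> {1..6} \<Longrightarrow> (\<Sum>y\<in>UNIV. C i y * c j $ y) = of_bool (i = j)"
    and "i \<in> {1..6}" "j \<in> {1..6}" "k \<in> {1..6}"
  shows "contract (A i) (B j) (C k) (T_gap a b c) = t_gap i j k"
proof -
  have "(\<Sum>m = 1..6. of_bool (j = m) * of_bool (k = m)) = (of_bool (j = k) :: complex)"
    using assms(5) by (subst sum.remove[of _ j]) (auto simp: of_bool_def)
  then have "(\<Sum>m = 1..6. contract (A i) (B j) (C k) (a 1 \<odot> b m \<otimes> c m)) = of_bool (i = 1) * of_bool (j = k)"
    using assms(4-6) by (simp add: contract_outer dual mult.assoc del: One_nat_def flip: sum_distrib_left)
  then have eq: "contract (A i) (B j) (C k) (T_gap a b c)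
    = of_bool (i = 1) * of_bool (j = k) + of_bool (i = 2) * of_bool (j = 6) * of_bool (k = 1)
      + (of_bool (i = 3) * of_bool (j = 5) * of_bool (k = 1) + of_bool (i = 3) * of_bool (j = 6) * of_bool (k = 3))
      + of_bool (i = 4) * of_bool (j = 5) * of_bool (k = 2) + of_bool (i = 5) * of_bool (j = 4) * of_bool (k = 3)
      + (of_bool (i = 6) * of_bool (j = 4) * of_bool (k = 2) + of_bool (i = 6) * of_bool (j = 5) * of_bool (k = 3))"
    using assms(4-6)
    by (simp add: T_gap_def outer_add outer_sum contract_add contract_sum contract_outer dual
        del: One_nat_def)
  consider "i = 1" | "i = 2" | "i = 3" | "i = 4" | "i = 5" | "i = 6"
    using assms(4) by force
  then show ?thesis
    unfolding eq t_gap_def by cases (auto simp: of_bool_def)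
qed

lemma contract_w:
  assumes dual: "\<And>i j. i \<in> {1..2} \<Longrightarrow> j \<in> {1..2} \<Longrightarrow> (\<Sum>y\<in>UNIV. E i y * e j $ y) = of_bool (i = j)"
    "\<And>i j. i \<in> {1..2} \<Longrightarrow> j \<in> {1..2} \<Longrightarrow> (\<Sum>y\<in>UNIV. F i y * f j $ y) = of_bool (i = j)"
    "\<And>i j. i \<in> {1..2} \<Longrightarrow> j \<in> {1..2} \<Longrightarrow> (\<Sum>y\<in>UNIV. G i y * g j $ y) = of_bool (i = j)"
    and "p \<in> {1..2}" "q \<in> {1..2}" "l \<in> {1..2}"
  shows "contract (E p) (F q) (G l) (e 1 \<odot> (f 1 \<otimes> g 1) + e 2 \<odot> (f 2 \<otimes> g 1 + f 1 \<otimes> g 2)) = t_w p q l"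
proof -
  have "contract (E p) (F q) (G l) (e 1 \<odot> (f 1 \<otimes> g 1) + e 2 \<odot> (f 2 \<otimes> g 1 + f 1 \<otimes> g 2))
    = of_bool (p = 1) * of_bool (q = 1) * of_bool (l = 1)
      + (of_bool (p = 2) * of_bool (q = 2) * of_bool (l = 1) + of_bool (p = 2) * of_bool (q = 1) * of_bool (l = 2))"
    using assms(4-6) by (simp add: outer_add contract_add contract_outer dual del: One_nat_def)
  then show ?thesis
    by (auto simp: t_w_def of_bool_def)
qed

text \<open>Applying products of dual basis vectors to every term turns a decomposition into one of
  the array \<open>t_biggap\<close> with the same number of terms.\<close>

lemma decomposable_T_biggap_ge_25:
  assumes "is_basis 6 a" and "is_basis 6 b" and "is_basis 6 c"
    and "is_basis 2 e" and "is_basis 2 f" and "is_basis 2 g"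
    and "decomposable r (T_biggap a b c e f g)"
  shows "25 \<le> r"
proof -
  obtain A where A: "\<And>i j. i \<in> {1..6} \<Longrightarrow> j \<in> {1..6} \<Longrightarrow> (\<Sum>y\<in>UNIV. A i y * a j $ y) = of_bool (i = j)"
    using is_basis_dual[OF assms(1)] unfolding of_bool_def by metis
  obtain B where B: "\<And>i j. i \<in> {1..6} \<Longrightarrow> j \<in> {1..6} \<Longrightarrow> (\<Sum>y\<in>UNIV. B i y * b j $ y) = of_bool (i = j)"
    using is_basis_dual[OF assms(2)] unfolding of_bool_def by metis
  obtain C where C: "\<And>i j. i \<in> {1..6} \<Longrightarrow> j \<in> {1..6} \<Longrightarrow> (\<Sum>y\<in>UNIV. C i y * c j $ y) = of_bool (i = j)"
    using is_basis_dual[OF assms(3)] unfolding of_bool_def by metis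
  obtain E where E: "\<And>i j. i \<in> {1..2} \<Longrightarrow> j \<in> {1..2} \<Longrightarrow> (\<Sum>y\<in>UNIV. E i y * e j $ y) = of_bool (i = j)"
    using is_basis_dual[OF assms(4)] unfolding of_bool_def by metis
  obtain F where F: "\<And>i j. i \<in> {1..2} \<Longrightarrow> j \<in> {1..2} \<Longrightarrow> (\<Sum>y\<in>UNIV. F i y * f j $ y) = of_bool (i = j)"
    using is_basis_dual[OF assms(5)] unfolding of_bool_def by metis
  obtain G where G: "\<And>i j. i \<in> {1..2} \<Longrightarrow> j \<in> {1..2} \<Longrightarrow> (\<Sum>y\<in>UNIV. G i y * g j $ y) = of_bool (i = j)"
    using is_basis_dual[OF assms(6)] unfolding of_bool_def by metis
  obtain u v w where T: "T_biggap a b c e f g = (\<Sum>s<r. u s \<odot> v s \<otimes> w s)"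
    using assms(7) unfolding decomposable_def by blast
  define pair where "pair = (\<lambda>(D :: nat \<Rightarrow> 6 \<Rightarrow> complex) (D' :: nat \<Rightarrow> 2 \<Rightarrow> complex) (x :: nat \<Rightarrow> complex ^ (6 \<times> 2)) s I.
    \<Sum>z\<in>UNIV. (case z of (y, y') \<Rightarrow> D (fst I) y * D' (snd I) y') * x s $ z)"
  show ?thesis
  proof (rule coordinate_rank_ge_25)
    fix I J K :: "nat \<times> nat"
    assume I: "I \<in> {1..6} \<times> {1..2}" and J: "J \<in> {1..6} \<times> {1..2}" and K: "K \<in> {1..6} \<times> {1..2}"
    have "(\<Sum>s<r. pair A E u s I * pair B F v s J * pair C G w s K)
      = contract (\<lambda>(y, y'). A (fst I) y * E (snd I) y') (\<lambda>(y, y'). B (fst J) y * F (snd J) y')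
          (\<lambda>(y, y'). C (fst K) y * G (snd K) y') (T_biggap a b c e f g)"
      unfolding T contract_sum contract_outer pair_def ..
    also have "\<dots> = contract (A (fst I)) (B (fst J)) (C (fst K)) (T_gap a b c)
        * contract (E (snd I)) (F (snd J)) (G (snd K)) (e 1 \<odot> (f 1 \<otimes> g 1) + e 2 \<odot> (f 2 \<otimes> g 1 + f 1 \<otimes> g 2))"
      unfolding T_biggap_def contract_kron ..
    also have "contract (A (fst I)) (B (fst J)) (C (fst K)) (T_gap a b c) = t_gap (fst I) (fst J) (fst K)"
      using I J K by (intro contract_T_gap A B C) auto
    also have "contract (E (snd I)) (F (snd J)) (G (snd K)) (e 1 \<odot> (f 1 \<otimes> g 1) + e 2 \<odot> (f 2 \<otimes> g 1 + f 1 \<otimes> g 2))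
        = t_w (snd I) (snd J) (snd K)"
      using I J K by (intro contract_w E F G) auto
    also have "t_gap (fst I) (fst J) (fst K) * t_w (snd I) (snd J) (snd K) = t_biggap I J K"
      by (simp add: t_biggap_def)
    finally show "(\<Sum>s<r. pair A E u s I * pair B F v s J * pair C G w s K) = t_biggap I J K" .
  qed
qed

subsection \<open>Border rank\<close>

lemma decomposable_outer: "decomposable 1 (u \<odot> v \<otimes> w)"
  by (rule decomposableI[of "{()}" _ _ "\<lambda>_. u" "\<lambda>_. v" "\<lambda>_. w"]) simp_all

lemma decomposable_add:
  assumes "decomposable m S" and "decomposable n T"
  shows "decomposable (m + n) (S + T)"
proof -
  obtain u v w where S: "S = (\<Sum>s<m. u s \<odot> v s \<otimes> w s)"
    using assms(1) unfolding decomposable_def by blast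
  obtain u' v' w' where T: "T = (\<Sum>s<n. u' s \<odot> v' s \<otimes> w' s)"
    using assms(2) unfolding decomposable_def by blast
  show ?thesis
    unfolding S T
    by (rule decomposableI[of "{..<m} <+> {..<n}" _ _ "case_sum u u'" "case_sum v v'" "case_sum w w'"])
      (simp_all add: sum.Plus card_Plus)
qed

lemma decomposable_kron:
  assumes "decomposable m S" and "decomposable n T"
  shows "decomposable (m * n) (S \<boxtimes> T)"
proof -
  obtain u v w where S: "S = (\<Sum>s<m. u s \<odot> v s \<otimes> w s)"
    using assms(1) unfolding decomposable_def by blast
  obtain u' v' w' where T: "T = (\<Sum>s<n. u' s \<odot> v' s \<otimes> w' s)"
    using assms(2) unfolding decomposable_def by blast
  show ?thesis
    unfolding S T
    by (rule decomposableI[of "{..<m} \<times> {..<n}" _ _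
          "\<lambda>(s, s'). \<chi> z. u s $ fst z * u' s' $ snd z" "\<lambda>(s, s'). \<chi> z. v s $ fst z * v' s' $ snd z"
          "\<lambda>(s, s'). \<chi> z. w s $ fst z * w' s' $ snd z"])
      (auto simp: vec_eq_iff kron3_def sum_product sum.cartesian_product case_prod_unfold mult_ac)
qed

section \<open>Invertible slices\<close>

definition slice ::
    "('a \<Rightarrow> complex) \<Rightarrow> ('a::finite, 'b::finite, 'c::finite) tensor3 \<Rightarrow> complex ^ 'c ^ 'b"
  where "slice \<alpha> T = (\<chi> j k. \<Sum>i\<in>UNIV. \<alpha> i * T $ i $ j $ k)"

lemma slice_nth: "slice \<alpha> T $ j $ k = (\<Sum>i\<in>UNIV. \<alpha> i * T $ i $ j $ k)"
  by (simp add: slice_def)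

text \<open>Every column of the slice lies in the span of the \<open>v s\<close>, and the columns of
  an invertible matrix span the whole space.\<close>

lemma card_le_if_det_slice_nonzero:
  fixes T :: "('a::finite, 'b::finite, 'b) tensor3"
  assumes "decomposable r T" and "det (slice \<alpha> T) \<noteq> 0"
  shows "CARD('b) \<le> r"
proof -
  obtain u v w where T: "T = (\<Sum>s<r. u s \<odot> v s \<otimes> w s)"
    using assms(1) unfolding decomposable_def by blast
  have "column k (slice \<alpha> T) \<in> vec.span (v ` {..<r})" for k
  proof -
    have "column k (slice \<alpha> T) = (\<Sum>s<r. ((\<Sum>i\<in>UNIV. \<alpha> i * u s $ i) * w s $ k) *s v s)"
      unfolding T
      by (simp add: vec_eq_iff column_def slice_nth sum_distrib_left sum_distrib_right mult_ac
          sum.swap[of _ "UNIV :: 'a set"])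
    also have "\<dots> \<in> vec.span (v ` {..<r})"
      by (intro vec.span_sum vec.span_scale vec.span_base imageI)
    finally show ?thesis .
  qed
  then have "vec.span (columns (slice \<alpha> T)) \<subseteq> vec.span (v ` {..<r})"
    by (intro vec.span_minimal) (auto simp: columns_def)
  moreover have "vec.span (columns (slice \<alpha> T)) = UNIV"
    using assms(2) matrix_right_invertible_span_columns[of "slice \<alpha> T"]
    by (auto simp: invertible_det_nz[symmetric] invertible_def)
  ultimately have "vec.dim (UNIV :: (complex ^ 'b) set) \<le> card (v ` {..<r})"
    by (intro vec.dim_le_card) auto
  also have "\<dots> \<le> r"
    using card_image_le[of "{..<r}" v] by simp
  finally show ?thesis
    by (simp only: vec_dim_card)
qed

lemma eventually_det_slice_nonzero:
  fixes T :: "('a::finite, 'b::finite, 'b) tensor3"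
  assumes "X \<longlonglongrightarrow> T" and "det (slice \<alpha> T) \<noteq> 0"
  shows "\<forall>\<^sub>F n in sequentially. det (slice \<alpha> (X n)) \<noteq> 0"
proof -
  have "(\<lambda>n. det (slice \<alpha> (X n))) \<longlonglongrightarrow> det (slice \<alpha> T)"
    unfolding det_def slice_nth using assms(1)
    by (intro tendsto_intros)
  then show ?thesis
    using assms(2) by (rule tendsto_imp_eventually_ne)
qed

text \<open>The invertible slice persists along any sequence tending to \<open>T\<close>, forcing
  rank at least \<open>CARD('b)\<close> eventually. As \<open>border_rank\<close> asks for rank
  exactly \<open>r\<close> at every index, the witness is a tail of \<open>X\<close>.\<close>

lemma border_rank_eqI:
  fixes T :: "('a::finite, 'b::finite, 'b) tensor3"
  assumes X: "X \<longlonglongrightarrow> T" and dec: "\<And>n. decomposable CARD('b) (X n)"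
    and det: "det (slice \<alpha> T) \<noteq> 0"
  shows "border_rank T = CARD('b)"
  unfolding border_rank_def
proof (rule Least_equality)
  obtain N where N: "\<And>n. n \<ge> N \<Longrightarrow> det (slice \<alpha> (X n)) \<noteq> 0"
    using eventually_det_slice_nonzero[OF X det] unfolding eventually_sequentially by blast
  have "tensor_rank (X (n + N)) = CARD('b)" for n
    using tensor_rank_le[OF dec] card_le_if_det_slice_nonzero[OF decomposable_tensor_rank N]
    by (simp add: le_antisym)
  with LIMSEQ_ignore_initial_segment[OF X, of N]
  show "\<exists>X. (\<forall>n. tensor_rank (X n) = CARD('b)) \<and> X \<longlonglongrightarrow> T"
    by (intro exI[of _ "\<lambda>n. X (n + N)"]) simp
next
  fix r assume "\<exists>X. (\<forall>n. tensor_rank (X n) = r) \<and> X \<longlonglongrightarrow> T"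
  then obtain Y where Y: "\<And>n. tensor_rank (Y n) = r" "Y \<longlonglongrightarrow> T"
    by blast
  obtain n where "det (slice \<alpha> (Y n)) \<noteq> 0"
    using eventually_det_slice_nonzero[OF Y(2) det] unfolding eventually_sequentially by blast
  then show "CARD('b) \<le> r"
    using card_le_if_det_slice_nonzero[OF decomposable_tensor_rank] Y(1) by metis
qed

text \<open>The matrix with columns \<open>x j\<close> times the transpose of the one with columns
  \<open>y j\<close> is inverted factor by factor: duality collapses the double sum, completeness
  evaluates the rest.\<close>

lemma dual_product:
  fixes x :: "nat \<Rightarrow> complex ^ 'n" and y :: "nat \<Rightarrow> complex ^ 'm"
  assumes "\<And>i j. i \<in> {1..n} \<Longrightarrow> j \<in> {1..n} \<Longrightarrow> (\<Sum>z\<in>UNIV. D i z * x j $ z) = (if i = j then 1 else 0)"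
    and "\<And>k l. (\<Sum>i=1..n. y i $ k * D' i l) = (if k = l then 1 else 0)"
  shows "(\<Sum>z\<in>UNIV. (\<Sum>i=1..n. D' i k * D i z) * (\<Sum>j=1..n. x j $ z * y j $ l)) = (if k = l then 1 else 0)"
proof -
  have "(\<Sum>z\<in>UNIV. (\<Sum>i=1..n. D' i k * D i z) * (\<Sum>j=1..n. x j $ z * y j $ l))
      = (\<Sum>z\<in>UNIV. \<Sum>i=1..n. \<Sum>j=1..n. D' i k * D i z * (x j $ z * y j $ l))"
    by (simp only: sum_product)
  also have "\<dots> = (\<Sum>i=1..n. \<Sum>z\<in>UNIV. \<Sum>j=1..n. D' i k * D i z * (x j $ z * y j $ l))"
    by (rule sum.swap)
  also have "\<dots> = (\<Sum>i=1..n. \<Sum>j=1..n. \<Sum>z\<in>UNIV. D' i k * D i z * (x j $ z * y j $ l))"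
    by (intro sum.cong refl sum.swap)
  also have "\<dots> = (\<Sum>i=1..n. \<Sum>j=1..n. D' i k * y j $ l * (\<Sum>z\<in>UNIV. D i z * x j $ z))"
    by (simp add: sum_distrib_left mult_ac)
  also have "\<dots> = (\<Sum>i=1..n. \<Sum>j=1..n. if i = j then D' i k * y j $ l else 0)"
    using assms(1) by (intro sum.cong) auto
  also have "\<dots> = (\<Sum>i=1..n. y i $ l * D' i k)"
    by (simp add: mult.commute)
  finally show ?thesis
    using assms(2)[of l k] by (cases "k = l") auto
qed

text \<open>The slice dual to \<open>a 1\<close> and \<open>e 2\<close> is the Kronecker product of
  \<open>P\<close> and \<open>Q\<close>, so the Kronecker product \<open>N\<close> of their inverses
  inverts it.\<close>

lemma det_slice_T_biggap:
  assumes "is_basis 6 a" and "is_basis 6 b" and "is_basis 6 c"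
    and "is_basis 2 e" and "is_basis 2 f" and "is_basis 2 g"
  obtains \<alpha> where "det (slice \<alpha> (T_biggap a b c e f g)) \<noteq> 0"
proof -
  obtain A where A: "\<And>i j. i \<in> {1..6} \<Longrightarrow> j \<in> {1..6} \<Longrightarrow> (\<Sum>y\<in>UNIV. A i y * a j $ y) = (if i = j then 1 else 0)"
    using is_basis_dual[OF assms(1)] by metis
  obtain E where E: "\<And>i j. i \<in> {1..2} \<Longrightarrow> j \<in> {1..2} \<Longrightarrow> (\<Sum>y\<in>UNIV. E i y * e j $ y) = (if i = j then 1 else 0)"
    using is_basis_dual[OF assms(4)] by metis
  obtain B where B: "\<And>i j. i \<in> {1..6} \<Longrightarrow> j \<in> {1..6} \<Longrightarrow> (\<Sum>y\<in>UNIV. B i y * b j $ y) = (if i = j then 1 else 0)"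
    using is_basis_dual[OF assms(2)] by metis
  obtain F where F: "\<And>i j. i \<in> {1..2} \<Longrightarrow> j \<in> {1..2} \<Longrightarrow> (\<Sum>y\<in>UNIV. F i y * f j $ y) = (if i = j then 1 else 0)"
    using is_basis_dual[OF assms(5)] by metis
  obtain C where C: "\<And>y z. (\<Sum>i=1..6. c i $ y * C i z) = (if y = z then 1 else 0)"
    using is_basis_dual[OF assms(3)] by metis
  obtain G where G: "\<And>y z. (\<Sum>i=1..2. g i $ y * G i z) = (if y = z then 1 else 0)"
    using is_basis_dual[OF assms(6)] by metis
  define \<alpha> where "\<alpha> = (\<lambda>(x, y). A 1 x * E 2 y)"
  define P where "P = (\<lambda>j k. \<Sum>i=1..6. b i $ j * c i $ k)"
  \<comment> \<open>The index \<open>3 - i\<close> swaps \<open>f 1\<close> and \<open>f 2\<close>,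
    which writes \<open>f 2 \<otimes> g 1 + f 1 \<otimes> g 2\<close> in the shape required by
    \<open>dual_product\<close>.\<close>
  define Q where "Q = (\<lambda>j k. \<Sum>i=1..2. f (3 - i) $ j * g i $ k)"
  define P' where "P' = (\<lambda>k j. \<Sum>i=1..6. C i k * B i j)"
  define Q' where "Q' = (\<lambda>k j. \<Sum>i=1..2. G i k * F (3 - i) j)"
  define N :: "complex ^ (6 \<times> 2) ^ (6 \<times> 2)"
    where "N = (\<chi> x y. P' (fst x) (fst y) * Q' (snd x) (snd y))"
  have P: "(\<Sum>z\<in>UNIV. P' k z * P z l) = (if k = l then 1 else 0)" for k l
    unfolding P_def P'_def by (rule dual_product[OF B C])
  have Q: "(\<Sum>z\<in>UNIV. Q' k z * Q z l) = (if k = l then 1 else 0)" for k l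
    unfolding Q_def Q'_def by (rule dual_product[OF F[THEN trans] G]) auto
  have gap: "(\<Sum>i\<in>UNIV. A 1 i * T_gap a b c $ i $ j $ k) = P j k" for j k
  proof -
    have "(\<Sum>i\<in>UNIV. A 1 i * T_gap a b c $ i $ j $ k)
      = (\<Sum>i\<in>UNIV. A 1 i * a 1 $ i) * P j k
      + (\<Sum>i\<in>UNIV. A 1 i * a 2 $ i) * (b 6 $ j * c 1 $ k)
      + (\<Sum>i\<in>UNIV. A 1 i * a 3 $ i) * (b 5 $ j * c 1 $ k + b 6 $ j * c 3 $ k)
      + (\<Sum>i\<in>UNIV. A 1 i * a 4 $ i) * (b 5 $ j * c 2 $ k)
      + (\<Sum>i\<in>UNIV. A 1 i * a 5 $ i) * (b 4 $ j * c 3 $ k)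
      + (\<Sum>i\<in>UNIV. A 1 i * a 6 $ i) * (b 4 $ j * c 2 $ k + b 5 $ j * c 3 $ k)"
      unfolding sum_distrib_right sum.distrib[symmetric] P_def
      by (intro sum.cong refl) (simp add: T_gap_def distrib_left mult.assoc)
    then show ?thesis by (simp add: A del: One_nat_def)
  qed
  have w: "(\<Sum>i\<in>UNIV. E 2 i * (e 1 \<odot> (f 1 \<otimes> g 1) + e 2 \<odot> (f 2 \<otimes> g 1 + f 1 \<otimes> g 2)) $ i $ j $ k)
      = Q j k" for j k
  proof -
    have "(\<Sum>i\<in>UNIV. E 2 i * (e 1 \<odot> (f 1 \<otimes> g 1) + e 2 \<odot> (f 2 \<otimes> g 1 + f 1 \<otimes> g 2)) $ i $ j $ k)
      = (\<Sum>i\<in>UNIV. E 2 i * e 1 $ i) * (f 1 $ j * g 1 $ k)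
      + (\<Sum>i\<in>UNIV. E 2 i * e 2 $ i) * (f 2 $ j * g 1 $ k + f 1 $ j * g 2 $ k)"
      unfolding sum_distrib_right sum.distrib[symmetric]
      by (intro sum.cong refl) (simp add: distrib_left mult.assoc)
    moreover have "{1..2 :: nat} = {1, 2}"
      by auto
    then have "Q j k = f 2 $ j * g 1 $ k + f 1 $ j * g 2 $ k"
      by (simp add: Q_def)
    ultimately show ?thesis by (simp add: E del: One_nat_def)
  qed
  have M: "slice \<alpha> (T_biggap a b c e f g) $ x $ y = P (fst x) (fst y) * Q (snd x) (snd y)" for x y
  proof -
    have "slice \<alpha> (T_biggap a b c e f g) $ x $ y
      = (\<Sum>i\<in>UNIV. A 1 i * T_gap a b c $ i $ fst x $ fst y)
      * (\<Sum>i\<in>UNIV. E 2 i * (e 1 \<odot> (f 1 \<otimes> g 1) + e 2 \<odot> (f 2 \<otimes> g 1 + f 1 \<otimes> g 2)) $ i $ snd x $ snd y)"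
      unfolding slice_nth sum_product sum.cartesian_product UNIV_Times_UNIV
      by (intro sum.cong) (auto simp: T_biggap_def kron3_def \<alpha>_def)
    then show ?thesis unfolding gap w .
  qed
  have "N ** slice \<alpha> (T_biggap a b c e f g) = mat 1"
  proof (intro vec_eq_iff[THEN iffD2] allI)
    fix x y
    have "(N ** slice \<alpha> (T_biggap a b c e f g)) $ x $ y
        = (\<Sum>z\<in>UNIV. P' (fst x) z * P z (fst y)) * (\<Sum>z\<in>UNIV. Q' (snd x) z * Q z (snd y))"
      unfolding matrix_matrix_mult_def sum_product sum.cartesian_product UNIV_Times_UNIV
      by (simp add: N_def M case_prod_unfold mult_ac)
    also have "\<dots> = mat 1 $ x $ y"
      by (auto simp: P Q mat_def prod_eq_iff)
    finally show "(N ** slice \<alpha> (T_biggap a b c e f g)) $ x $ y = mat 1 $ x $ y" .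
  qed
  then have "det N * det (slice \<alpha> (T_biggap a b c e f g)) = 1"
    by (metis det_mul det_I)
  then show ?thesis
    using that by force
qed

lemma tensor_tendstoI:
  fixes X :: "'t \<Rightarrow> ('a::finite, 'b::finite, 'c::finite) tensor3"
  assumes "\<And>i j k. ((\<lambda>t. X t $ i $ j $ k) \<longlongrightarrow> T $ i $ j $ k) F"
  shows "(X \<longlongrightarrow> T) F"
  by (intro vec_tendstoI assms)

lemma tendsto_kron:
  assumes "(X \<longlongrightarrow> S) F" and "(Y \<longlongrightarrow> T) F"
  shows "((\<lambda>t. X t \<boxtimes> Y t) \<longlongrightarrow> S \<boxtimes> T) F"
  by (rule tensor_tendstoI) (simp only: kron3_def vec_lambda_beta, intro tendsto_intros assms)

text \<open>For removable singularities: \<open>f\<close> contains divisions by \<open>t\<close>,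
  and \<open>g\<close> is the expression after cancellation.\<close>

lemma tendsto_at_0_polynomial_extension:
  fixes f g :: "complex \<Rightarrow> complex"
  assumes "\<And>t. t \<noteq> 0 \<Longrightarrow> f t = g t" and "continuous_on UNIV g" and "g 0 = l"
  shows "(f \<longlongrightarrow> l) (at 0)"
proof -
  have "(g \<longlongrightarrow> g 0) (at 0)"
    using assms(2) by (simp add: continuous_on)
  moreover have "\<forall>\<^sub>F t in at 0. g t = f t"
    using assms(1) by (auto simp: eventually_at_filter)
  ultimately show ?thesis
    using assms(3) by (auto elim: Lim_transform_eventually)
qed

subsection \<open>The degeneration\<close>

text \<open>A difference quotient: the W tensor is the derivative at \<open>t = 0\<close> of the
  curve \<open>(e 2 + t *s e 1) \<odot> (f 1 + t *s f 2) \<otimes> (g 1 + t *s g 2)\<close> of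
  simple tensors.\<close>

definition w_approx ::
    "(nat \<Rightarrow> complex ^ 2) \<Rightarrow> (nat \<Rightarrow> complex ^ 2) \<Rightarrow> (nat \<Rightarrow> complex ^ 2) \<Rightarrow> complex \<Rightarrow> (2, 2, 2) tensor3"
  where "w_approx e f g t =
      ((1 / t) *s (e 2 + t *s e 1)) \<odot> (f 1 + t *s f 2) \<otimes> (g 1 + t *s g 2)
    + (- (1 / t) *s e 2) \<odot> f 1 \<otimes> g 1"

lemma decomposable_w_approx: "decomposable 2 (w_approx e f g t)"
  unfolding w_approx_def
  using decomposable_add[OF decomposable_outer decomposable_outer] by (simp only: one_add_one)

lemma tendsto_w_approx:
  "(w_approx e f g \<longlongrightarrow> e 1 \<odot> (f 1 \<otimes> g 1) + e 2 \<odot> (f 2 \<otimes> g 1 + f 1 \<otimes> g 2)) (at 0)"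
proof (rule tensor_tendstoI, rule tendsto_at_0_polynomial_extension)
  fix i j k and t :: complex
  assume "t \<noteq> 0"
  then show "w_approx e f g t $ i $ j $ k
    = e 1 $ i * f 1 $ j * g 1 $ k + e 2 $ i * (f 2 $ j * g 1 $ k + f 1 $ j * g 2 $ k)
      + t * (e 1 $ i * (f 2 $ j * g 1 $ k + f 1 $ j * g 2 $ k) + e 2 $ i * f 2 $ j * g 2 $ k)
      + t\<^sup>2 * (e 1 $ i * f 2 $ j * g 2 $ k)"
    by (simp add: w_approx_def field_simps power2_eq_square)
qed (intro continuous_intros, simp)

text \<open>
  The first-order terms of the four conic points cancel \<open>b\<^sub>5 \<otimes> c\<^sub>1 + b\<^sub>6 \<otimes> c\<^sub>3\<close> in the relation with
  weights \<open>\<tau> / 4\<close>; the second-order terms contribute \<open>b\<^sub>2 \<otimes> c\<^sub>2 + \<dots> + b\<^sub>5 \<otimes> c\<^sub>5\<close> and cancel the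
  unwanted \<open>b\<^sub>5 \<otimes> c\<^sub>3\<close>.
\<close>

definition conic_b :: "(nat \<Rightarrow> complex ^ 6) \<Rightarrow> complex \<Rightarrow> complex \<Rightarrow> complex ^ 6"
  where "conic_b b t \<tau> =
    b 5 + \<tau> *s b 4 - (t * \<tau> ^ 2) *s b 6 + t\<^sup>2 *s (\<tau> ^ 3 *s b 2 + \<tau> ^ 2 *s b 3)"

definition conic_c :: "(nat \<Rightarrow> complex ^ 6) \<Rightarrow> complex \<Rightarrow> complex \<Rightarrow> complex ^ 6"
  where "conic_c c t \<tau> =
    c 2 + \<tau> *s c 3 - (t * \<tau> ^ 3) *s c 1 + t\<^sup>2 *s (\<tau> ^ 3 *s (c 5 - c 3) + \<tau> ^ 2 *s c 4)"

text \<open>Averaging over the fourth roots of unity, the weights \<open>1\<close>,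
  \<open>\<tau> ^ 3\<close>, \<open>\<tau> ^ 2\<close>, \<open>\<tau>\<close> extract the parts
  whose degree in \<open>\<tau>\<close> is 0, 1, 2, 3 modulo 4. The first three give the slices of
  \<open>a 4\<close>, \<open>a 6\<close>, \<open>a 5\<close> in the limit; the last enters the slice
  of \<open>a 1\<close>.\<close>

definition conic_a :: "(nat \<Rightarrow> complex ^ 6) \<Rightarrow> complex \<Rightarrow> complex \<Rightarrow> complex ^ 6"
  where "conic_a a t \<tau> = (1 / 4) *s ((\<tau> / t\<^sup>2) *s a 1 + a 4 + \<tau> ^ 3 *s a 6 + \<tau> ^ 2 *s a 5)"

text \<open>The \<open>a 1\<close> parts of the first two terms form a second-order quotient along a
  curve through \<open>b 6 \<otimes> c 1\<close>. Its pole of order one cancels against the conic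
  points, and its second-order part supplies
  \<open>b 1 \<otimes> c 1 + b 6 \<otimes> c 6\<close>.\<close>

definition gap_approx ::
    "(nat \<Rightarrow> complex ^ 6) \<Rightarrow> (nat \<Rightarrow> complex ^ 6) \<Rightarrow> (nat \<Rightarrow> complex ^ 6) \<Rightarrow> complex \<Rightarrow> (6, 6, 6) tensor3"
  where "gap_approx a b c t =
      (a 2 - (1 / t\<^sup>2) *s a 1 - (1 / t) *s a 3) \<odot> b 6 \<otimes> c 1
    + ((1 / t\<^sup>2) *s a 1 + (1 / t) *s a 3) \<odot> (b 6 + t *s b 5 + t\<^sup>2 *s b 1) \<otimes> (c 1 + t *s c 3 + t\<^sup>2 *s c 6)
    + conic_a a t 1 \<odot> conic_b b t 1 \<otimes> conic_c c t 1
    + conic_a a t (- 1) \<odot> conic_b b t (- 1) \<otimes> conic_c c t (- 1)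
    + conic_a a t \<i> \<odot> conic_b b t \<i> \<otimes> conic_c c t \<i>
    + conic_a a t (- \<i>) \<odot> conic_b b t (- \<i>) \<otimes> conic_c c t (- \<i>)"

lemma decomposable_gap_approx: "decomposable 6 (gap_approx a b c t)"
proof -
  have "decomposable (1 + 1 + 1 + 1 + 1 + 1) (gap_approx a b c t)"
    unfolding gap_approx_def by (intro decomposable_add decomposable_outer)
  moreover have "1 + 1 + 1 + 1 + 1 + 1 = (6 :: nat)"
    by simp
  ultimately show ?thesis
    by (rule subst[of _ _ "\<lambda>n. decomposable n _", rotated])
qed

text \<open>The weighted sum keeps exactly the powers of \<open>\<tau>\<close> congruent to 3 modulo
  4. None occurs in order 0, 3 or 4 in \<open>t\<close>, so the identity is exact.\<close>

lemma conic_identity: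
  fixes b1 b2 b3 b4 b5 b6 c1 c2 c3 c4 c5 c6 t :: complex
  defines "q \<equiv> \<lambda>\<tau>. (b5 + \<tau> * b4 - t * \<tau> ^ 2 * b6 + t\<^sup>2 * (\<tau> ^ 3 * b2 + \<tau> ^ 2 * b3))
    * (c2 + \<tau> * c3 - t * \<tau> ^ 3 * c1 + t\<^sup>2 * (\<tau> ^ 3 * (c5 - c3) + \<tau> ^ 2 * c4))"
  shows "q 1 - q (- 1) + \<i> * q \<i> - \<i> * q (- \<i>)
    = 4 * (t\<^sup>2 * (b2 * c2 + b3 * c3 + b4 * c4 + b5 * c5 - b5 * c3) - t * (b5 * c1 + b6 * c3))"
proof -
  \<comment> \<open>These are the even and odd parts of the two factors in \<open>\<tau>\<close>;
    primes refer to \<open>\<tau> = \<i>\<close>, with the factor \<open>\<i>\<close> taken out of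
    the odd parts.\<close>
  define P P' where "P = b5 - t * b6 + t\<^sup>2 * b3" and "P' = b5 + t * b6 - t\<^sup>2 * b3"
  define R R' where "R = b4 + t\<^sup>2 * b2" and "R' = b4 - t\<^sup>2 * b2"
  define S S' where "S = c2 + t\<^sup>2 * c4" and "S' = c2 - t\<^sup>2 * c4"
  define U U' where "U = c3 - t * c1 + t\<^sup>2 * (c5 - c3)" and "U' = c3 + t * c1 - t\<^sup>2 * (c5 - c3)"
  note defs = P_def P'_def R_def R'_def S_def S'_def U_def U'_def
  have q: "q 1 = (P + R) * (S + U)" "q (- 1) = (P - R) * (S - U)"
    "q \<i> = (P' + \<i> * R') * (S' + \<i> * U')" "q (- \<i>) = (P' - \<i> * R') * (S' - \<i> * U')"
    unfolding q_def defs
    by (intro arg_cong2[where f = "(*)"]; simp add: algebra_simps power3_eq_cube)+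
  have "q 1 - q (- 1) + \<i> * q \<i> - \<i> * q (- \<i>) = 2 * (P * U - P' * U' + R * S - R' * S')"
    unfolding q by (simp add: algebra_simps)
  then show ?thesis
    unfolding defs by (simp add: algebra_simps power2_eq_square)
qed

text \<open>Regrouping by the \<open>a\<close> vectors turns the six terms into difference quotients
  of \<open>p - r\<close> and Fourier sums of \<open>q1\<close>, ..., \<open>q4\<close>, the values
  at \<open>1\<close>, \<open>- 1\<close>, \<open>\<i>\<close>, \<open>- \<i>\<close>.\<close>

lemma gap_approx_scalar_identity:
  fixes a1 a2 a3 a4 a5 a6 r p q1 q2 q3 q4 t :: complex
  shows "(a2 - 1 / t\<^sup>2 * a1 - 1 / t * a3) * r + (1 / t\<^sup>2 * a1 + 1 / t * a3) * p
      + 1 / 4 * (1 / t\<^sup>2 * a1 + a4 + 1 ^ 3 * a6 + 1\<^sup>2 * a5) * q1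
      + 1 / 4 * ((- 1) / t\<^sup>2 * a1 + a4 + (- 1) ^ 3 * a6 + (- 1)\<^sup>2 * a5) * q2
      + 1 / 4 * (\<i> / t\<^sup>2 * a1 + a4 + \<i> ^ 3 * a6 + \<i>\<^sup>2 * a5) * q3
      + 1 / 4 * ((- \<i>) / t\<^sup>2 * a1 + a4 + (- \<i>) ^ 3 * a6 + (- \<i>)\<^sup>2 * a5) * q4
    = a1 * ((p - r + (q1 - q2 + \<i> * q3 - \<i> * q4) / 4) / t\<^sup>2) + a2 * r + a3 * ((p - r) / t)
      + a4 * ((q1 + q2 + q3 + q4) / 4) + a5 * ((q1 + q2 - q3 - q4) / 4)
      + a6 * ((q1 - q2 - \<i> * q3 + \<i> * q4) / 4)"
proof -
  \<comment> \<open>With the inverse powers of \<open>t\<close> as opaque factors, only a polynomial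
    identity remains, valid for every \<open>t\<close>.\<close>
  define x y where "x = 1 / t\<^sup>2" and "y = 1 / t"
  have x: "z / t\<^sup>2 = z * x" "z / t = z * y" for z
    by (simp_all add: x_def y_def)
  have pow: "\<i> ^ 3 = - \<i>" "(- \<i>) ^ 3 = \<i>"
    by (simp_all add: power3_eq_cube)
  show ?thesis
    unfolding x pow by (simp add: algebra_simps add_divide_distrib diff_divide_distrib)
qed

lemma tendsto_gap_approx: "(gap_approx a b c \<longlongrightarrow> T_gap a b c) (at 0)"
proof (rule tensor_tendstoI, rule tendsto_at_0_polynomial_extension)
  fix i j k
  define q where "q = (\<lambda>t \<tau>. conic_b b t \<tau> $ j * conic_c c t \<tau> $ k)"
  \<comment> \<open>An entry of \<open>gap_approx\<close> after all poles have cancelled.\<close>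
  define g where "g = (\<lambda>t.
      a 1 $ i * ((\<Sum>m=1..6. b m $ j * c m $ k) + t * (b 1 $ j * c 3 $ k + b 5 $ j * c 6 $ k) + t\<^sup>2 * (b 1 $ j * c 6 $ k))
    + a 2 $ i * (b 6 $ j * c 1 $ k)
    + a 3 $ i * (b 5 $ j * c 1 $ k + b 6 $ j * c 3 $ k + t * (b 5 $ j * c 3 $ k + b 1 $ j * c 1 $ k + b 6 $ j * c 6 $ k)
        + t\<^sup>2 * (b 1 $ j * c 3 $ k + b 5 $ j * c 6 $ k) + t ^ 3 * (b 1 $ j * c 6 $ k))
    + a 4 $ i * ((q t 1 + q t (- 1) + q t \<i> + q t (- \<i>)) / 4)
    + a 5 $ i * ((q t 1 + q t (- 1) - q t \<i> - q t (- \<i>)) / 4)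
    + a 6 $ i * ((q t 1 - q t (- 1) - \<i> * q t \<i> + \<i> * q t (- \<i>)) / 4))"
  have sum: "(\<Sum>m=1..6. h m) = h 1 + h 2 + h 3 + h 4 + h 5 + h 6" for h :: "nat \<Rightarrow> complex"
    by (simp add: eval_nat_numeral)
  note nth = vector_add_component vector_minus_component vector_smult_component outer_nth
  have qt: "q t \<tau> = (b 5 $ j + \<tau> * b 4 $ j - t * \<tau> ^ 2 * b 6 $ j + t\<^sup>2 * (\<tau> ^ 3 * b 2 $ j + \<tau> ^ 2 * b 3 $ j))
    * (c 2 $ k + \<tau> * c 3 $ k - t * \<tau> ^ 3 * c 1 $ k + t\<^sup>2 * (\<tau> ^ 3 * (c 5 $ k - c 3 $ k) + \<tau> ^ 2 * c 4 $ k))"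
    for t \<tau>
    by (simp only: q_def conic_b_def conic_c_def nth)
  show "gap_approx a b c t $ i $ j $ k = g t" if "t \<noteq> 0" for t
  proof -
    have q: "q t 1 - q t (- 1) + \<i> * q t \<i> - \<i> * q t (- \<i>)
      = 4 * (t\<^sup>2 * (b 2 $ j * c 2 $ k + b 3 $ j * c 3 $ k + b 4 $ j * c 4 $ k + b 5 $ j * c 5 $ k - b 5 $ j * c 3 $ k)
          - t * (b 5 $ j * c 1 $ k + b 6 $ j * c 3 $ k))"
      unfolding qt by (rule conic_identity)
    define p where "p = (b 6 $ j + t * b 5 $ j + t\<^sup>2 * b 1 $ j) * (c 1 $ k + t * c 3 $ k + t\<^sup>2 * c 6 $ k)"
    have p: "p = b 6 $ j * c 1 $ k + t * (b 5 $ j * c 1 $ k + b 6 $ j * c 3 $ k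
        + t * (b 5 $ j * c 3 $ k + b 1 $ j * c 1 $ k + b 6 $ j * c 6 $ k)
        + t\<^sup>2 * (b 1 $ j * c 3 $ k + b 5 $ j * c 6 $ k) + t ^ 3 * (b 1 $ j * c 6 $ k))"
      unfolding p_def by (simp add: algebra_simps power2_eq_square power3_eq_cube)
    have "gap_approx a b c t $ i $ j $ k
      = a 1 $ i * ((p - b 6 $ j * c 1 $ k + (q t 1 - q t (- 1) + \<i> * q t \<i> - \<i> * q t (- \<i>)) / 4) / t\<^sup>2)
      + a 2 $ i * (b 6 $ j * c 1 $ k)
      + a 3 $ i * ((p - b 6 $ j * c 1 $ k) / t)
      + a 4 $ i * ((q t 1 + q t (- 1) + q t \<i> + q t (- \<i>)) / 4)
      + a 5 $ i * ((q t 1 + q t (- 1) - q t \<i> - q t (- \<i>)) / 4)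
      + a 6 $ i * ((q t 1 - q t (- 1) - \<i> * q t \<i> + \<i> * q t (- \<i>)) / 4)"
      unfolding gap_approx_def conic_a_def p_def q_def nth by (rule gap_approx_scalar_identity)
    also have "(p - b 6 $ j * c 1 $ k) / t = b 5 $ j * c 1 $ k + b 6 $ j * c 3 $ k
        + t * (b 5 $ j * c 3 $ k + b 1 $ j * c 1 $ k + b 6 $ j * c 6 $ k)
        + t\<^sup>2 * (b 1 $ j * c 3 $ k + b 5 $ j * c 6 $ k) + t ^ 3 * (b 1 $ j * c 6 $ k)"
      unfolding p using that by simp
    also have "(p - b 6 $ j * c 1 $ k + (q t 1 - q t (- 1) + \<i> * q t \<i> - \<i> * q t (- \<i>)) / 4) / t\<^sup>2
        = (\<Sum>m=1..6. b m $ j * c m $ k) + t * (b 1 $ j * c 3 $ k + b 5 $ j * c 6 $ k) + t\<^sup>2 * (b 1 $ j * c 6 $ k)"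
    proof -
      have "p - b 6 $ j * c 1 $ k + (q t 1 - q t (- 1) + \<i> * q t \<i> - \<i> * q t (- \<i>)) / 4
        = ((\<Sum>m=1..6. b m $ j * c m $ k) + t * (b 1 $ j * c 3 $ k + b 5 $ j * c 6 $ k) + t\<^sup>2 * (b 1 $ j * c 6 $ k)) * t\<^sup>2"
        unfolding p q sum nonzero_mult_div_cancel_left[OF zero_neq_numeral[symmetric]]
        by (simp add: algebra_simps power2_eq_square power3_eq_cube)
      then show ?thesis using that by simp
    qed
    finally show ?thesis
      unfolding g_def .
  qed
  have "continuous_on UNIV (\<lambda>t. q t \<tau>)" for \<tau>
    unfolding qt by (intro continuous_intros)
  then show "continuous_on UNIV g"
    unfolding g_def by (auto intro!: continuous_intros)
  have q0: "q 0 \<tau> = (b 5 $ j + \<tau> * b 4 $ j) * (c 2 $ k + \<tau> * c 3 $ k)" for \<tau>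
    by (simp add: qt)
  \<comment> \<open>Fourier inversion on the conic \<open>q0\<close>: the coefficients of
    \<open>1\<close>, \<open>\<tau> ^ 2\<close> and \<open>\<tau>\<close>, in this order.\<close>
  have "(q 0 1 + q 0 (- 1) + q 0 \<i> + q 0 (- \<i>)) / 4 = b 5 $ j * c 2 $ k"
    "(q 0 1 + q 0 (- 1) - q 0 \<i> - q 0 (- \<i>)) / 4 = b 4 $ j * c 3 $ k"
    "(q 0 1 - q 0 (- 1) - \<i> * q 0 \<i> + \<i> * q 0 (- \<i>)) / 4 = b 4 $ j * c 2 $ k + b 5 $ j * c 3 $ k"
    unfolding q0 by (simp_all add: algebra_simps)
  then show "g 0 = T_gap a b c $ i $ j $ k"
    unfolding g_def by (simp add: T_gap_def sum_component)
qed

theorem proposition6p11: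
  fixes a b c :: "nat \<Rightarrow> complex ^ 6" and e f g :: "nat \<Rightarrow> complex ^ 2"
  assumes "is_basis 6 a" and "is_basis 6 b" and "is_basis 6 c"
    and "is_basis 2 e" and "is_basis 2 f" and "is_basis 2 g"
  shows "border_rank (T_biggap a b c e f g) = 12 \<and> tensor_rank (T_biggap a b c e f g) \<ge> 25"
proof
  define X where "X = (\<lambda>n. gap_approx a b c (of_real (inverse (real (Suc n))))
    \<boxtimes> w_approx e f g (of_real (inverse (real (Suc n)))))"
  have "(\<lambda>n. of_real (inverse (real (Suc n))) :: complex) \<longlonglongrightarrow> 0"
    using tendsto_of_real[OF LIMSEQ_inverse_real_of_nat, where ?'a = complex] by simp
  then have "filterlim (\<lambda>n. of_real (inverse (real (Suc n))) :: complex) (at 0) sequentially"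
    by (intro filterlim_atI) (auto simp del: of_nat_Suc)
  then have "X \<longlonglongrightarrow> T_biggap a b c e f g"
    unfolding X_def T_biggap_def
    by (intro tendsto_kron filterlim_compose[OF tendsto_gap_approx] filterlim_compose[OF tendsto_w_approx])
  \<comment> \<open>Multiplying the two degenerations gives \<open>6 * 2 = 12\<close> terms,
    matching the size of the slices.\<close>
  moreover have "decomposable CARD(6 \<times> 2) (X n)" for n
    unfolding X_def using decomposable_kron[OF decomposable_gap_approx decomposable_w_approx] by simp
  moreover obtain \<alpha> where "det (slice \<alpha> (T_biggap a b c e f g)) \<noteq> 0"
    using det_slice_T_biggap[OF assms] .
  ultimately have "border_rank (T_biggap a b c e f g) = CARD(6 \<times> 2)"
    by (rule border_rank_eqI)
  then show "border_rank (T_biggap a b c e f g) = 12"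
    by simp
  show "tensor_rank (T_biggap a b c e f g) \<ge> 25"
    by (rule decomposable_T_biggap_ge_25[OF assms decomposable_tensor_rank])
qed

end
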